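(* Let $G$ be a finite abelian group of order $N$, let $S\subseteq G\setminus\{0\}$ satisfy $S=-S$, and let $K$ be a field with $\operatorname{char}(K)\nmid N$. Then $\dim_K\mathcal{A}_K(\mathrm{Cay}(G,S))$ equals the number of distinct eigenvalues of $A$ in $\overline{K}$.
   Context: $G$ is written additively. $\mathrm{Cay}(G,S)$ is the graph with vertex set $G$ and edges $\{g,g+s\}$ for $g\in G$, $s\in S$. Its adjacency matrix $A$, with rows and columns indexed by $G$, has $A_{g,h}=1$ if $h-g\in S$ and $A_{g,h}=0$ otherwise; it is regarded as a matrix over $K$. The spectral algebra is $\mathcal{A}_K(\mathrm{Cay}(G,S))=K[A]=\{f(A):f\in K[x]\}\subseteq M_N(K)$. $\overline{K}$ is an algebraic closure of $K$. *)

theory Defs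
  imports
    "HOL-Analysis.Analysis"
    "HOL-Algebra.Algebraic_Closure_Type"
    "HOL-Computational_Algebra.Polynomial"
begin

(* The notation 'k ^ 'g would force the sort of the index type 'g to be finite only. *)
type_synonym ('k, 'n) sq_matrix = "(('k, 'n) vec, 'n) vec"

definition cayley_edges :: "'g::ab_group_add set \<Rightarrow> 'g set set" where
  "cayley_edges S = {{g, g + s} | g s. s \<in> S}"

definition cayley_adj :: "'g::{ab_group_add,finite} set \<Rightarrow> ('k::field, 'g) sq_matrix" where
  "cayley_adj S = (\<chi> g h. if h - g \<in> S then 1 else 0)"

lemma cayley_adj_eq_edges:
  fixes S :: "'g::{ab_group_add,finite} set"
  assumes "S = uminus ` S"
  shows "(cayley_adj S :: ('k::field, 'g) sq_matrix) $ g $ h = (if {g, h} \<in> cayley_edges S then 1 else 0)"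
proof -
  have neg: "- x \<in> S" if "x \<in> S" for x
    using assms that by blast
  have "{g, h} \<in> cayley_edges S \<longleftrightarrow> h - g \<in> S"
  proof
    assume "{g, h} \<in> cayley_edges S"
    then obtain a s where "{g, h} = {a, a + s}" and s: "s \<in> S"
      unfolding cayley_edges_def by blast
    then have "h - g = s \<or> h - g = - s"
      by (auto simp: doubleton_eq_iff)
    then show "h - g \<in> S"
      using s neg by auto
  next
    assume "h - g \<in> S"
    moreover have "{g, h} = {g, g + (h - g)}"
      by simp
    ultimately show "{g, h} \<in> cayley_edges S"
      unfolding cayley_edges_def by blast
  qed
  then show ?thesis
    by (simp add: cayley_adj_def)
qed

(* The product of the type class instance on vectors, and hence the power operator,
   is componentwise, so powers with respect to the matrix product are defined here. *)
primrec matpow :: "'k::semiring_1 ^ 'n::finite ^ 'n \<Rightarrow> nat \<Rightarrow> 'k ^ 'n ^ 'n" where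
  "matpow A 0 = mat 1"
| "matpow A (Suc n) = A ** matpow A n"

definition matscale :: "'k::times \<Rightarrow> 'k ^ 'n::finite ^ 'm::finite \<Rightarrow> 'k ^ 'n ^ 'm" where
  "matscale c M = (\<chi> i j. c * M $ i $ j)"

definition matpoly :: "'k::comm_semiring_1 poly \<Rightarrow> 'k ^ 'n::finite ^ 'n \<Rightarrow> 'k ^ 'n ^ 'n" where
  "matpoly f A = (\<Sum>i\<le>Polynomial.degree f. matscale (Polynomial.coeff f i) (matpow A i))"

definition matpoly_algebra :: "('k::field, 'n::finite) sq_matrix \<Rightarrow> ('k, 'n) sq_matrix set" where
  "matpoly_algebra A = {matpoly f A | f. True}"

definition spectral_algebra :: "'g::{ab_group_add,finite} set \<Rightarrow> ('k::field, 'g) sq_matrix set" where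
  "spectral_algebra S = matpoly_algebra (cayley_adj S)"

definition eigenvalues :: "('k::field, 'n::finite) sq_matrix \<Rightarrow> 'k set" where
  "eigenvalues M = {\<mu>. \<exists>v. v \<noteq> 0 \<and> M *v v = \<mu> *s v}"

interpretation matrix_space:
  vector_space "matscale :: 'k::field \<Rightarrow> 'k ^ 'n::finite ^ 'm::finite \<Rightarrow> 'k ^ 'n ^ 'm"
  by unfold_locales (simp_all add: matscale_def vec_eq_iff algebra_simps)

lemma matpoly_upto:
  assumes "Polynomial.degree f \<le> n"
  shows "matpoly f A = (\<Sum>i\<le>n. matscale (Polynomial.coeff f i) (matpow A i))"
  unfolding matpoly_def
  by (rule sum.mono_neutral_left)
     (use assms in \<open>auto simp: matscale_def vec_eq_iff Polynomial.coeff_eq_0\<close>)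

(* dim of a set is by definition the dimension of its span *)
lemma subspace_matpoly_algebra: "matrix_space.subspace (matpoly_algebra A)"
proof (rule matrix_space.subspaceI)
  have "matpoly 0 A = 0"
    by (simp add: matpoly_def matscale_def vec_eq_iff)
  then show "0 \<in> matpoly_algebra A"
    unfolding matpoly_algebra_def by (metis (mono_tags, lifting) mem_Collect_eq)
next
  fix x y assume "x \<in> matpoly_algebra A" "y \<in> matpoly_algebra A"
  then obtain f g where fg: "x = matpoly f A" "y = matpoly g A"
    unfolding matpoly_algebra_def by blast
  let ?n = "max (Polynomial.degree f) (Polynomial.degree g)"
  have "x + y = matpoly (f + g) A"
    unfolding fg using matpoly_upto[of f ?n A] matpoly_upto[of g ?n A]
      matpoly_upto[of "f + g" ?n A] Polynomial.degree_add_le_max[of f g]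
    by (simp add: sum.distrib matrix_space.scale_left_distrib)
  then show "x + y \<in> matpoly_algebra A"
    unfolding matpoly_algebra_def by blast
next
  fix c x assume "x \<in> matpoly_algebra A"
  then obtain f where f: "x = matpoly f A"
    unfolding matpoly_algebra_def by blast
  have "matscale c x = matpoly (Polynomial.smult c f) A"
    unfolding f using matpoly_upto[of f "Polynomial.degree f" A] matpoly_upto[of "Polynomial.smult c f" "Polynomial.degree f" A]
    by (simp add: matrix_space.scale_sum_right)
  then show "matscale c x \<in> matpoly_algebra A"
    unfolding matpoly_algebra_def by blast
qed

end

theory Submission
  imports Defs
begin

text \<open>
  Since the characteristic does not divide \<open>N\<close>, the algebraic closure \<open>L\<close> of \<open>K\<close> contains \<open>N\<close>
  distinct \<open>N\<close>-th roots of unity, so the commuting translation operators of \<open>L\<^sup>G\<close> can be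
  diagonalized simultaneously, by averaging over their orbits.  As \<open>A\<close> is a sum of translations, its eigenvectors span, and \<open>r = \<Prod>(x - \<mu>)\<close>, taken over the \<open>d\<close> distinct
  eigenvalues, annihilates \<open>A\<close>.  Applying a \<open>K\<close>-linear map \<open>L \<rightarrow> K\<close> that fixes 1 to the coefficients
  of \<open>r\<close> gives a monic polynomial of degree \<open>d\<close> over \<open>K\<close> that annihilates \<open>A\<close>.  No nonzero polynomial
  of smaller degree does, because it would vanish at all \<open>d\<close> eigenvalues; so
  \<open>1, A, \<dots>, A\<^bsup>d-1\<^esup>\<close> is a basis of \<open>K[A]\<close>.
\<close>

section \<open>Roots of unity\<close>

text \<open>A polynomial over an algebraically closed field splits into linear factors, and a
  repeated factor would give a common root of \<open>p\<close> and its derivative.\<close>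

lemma card_roots_eq_degree:
  fixes p :: "'a::alg_closed_field poly"
  assumes "p \<noteq> 0" and sep: "\<And>x. poly p x = 0 \<Longrightarrow> poly (pderiv p) x \<noteq> 0"
  shows "card {x. poly p x = 0} = Polynomial.degree p"
proof -
  obtain A where A: "size A = Polynomial.degree p"
    "p = Polynomial.smult (Polynomial.lead_coeff p) (\<Prod>x\<in>#A. [:-x, 1:])"
    using alg_closed_imp_factorization[OF assms(1)] by blast
  have roots: "{x. poly p x = 0} = set_mset A"
    using assms(1) by (subst A(2)) (auto simp: poly_prod_mset prod_mset_zero_iff)
  have "count A x = 1" if "x \<in># A" for x
  proof (rule ccontr)
    assume "count A x \<noteq> 1"
    obtain B where B: "A = add_mset x B"
      using \<open>x \<in># A\<close> by (metis insert_DiffM)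
    with \<open>count A x \<noteq> 1\<close> have "x \<in># B"
      by (metis One_nat_def count_add_mset not_in_iff)
    then obtain C where C: "B = add_mset x C"
      by (metis insert_DiffM)
    define q where "q = Polynomial.smult (Polynomial.lead_coeff p) (\<Prod>x\<in>#C. [:-x, 1:])"
    have p: "p = [:-x, 1:] * ([:-x, 1:] * q)"
      by (subst A(2)) (simp add: B C q_def ac_simps mult_smult_right)
    have "poly p x = 0" "poly (pderiv p) x = 0"
      by (simp_all only: p pderiv_mult poly_mult poly_add) simp_all
    then show False
      using sep by blast
  qed
  then have "size A = card (set_mset A)"
    by (simp add: size_multiset_overloaded_eq)
  then show ?thesis
    using A(1) roots by simp
qed

text \<open>The derivative n x^(n-1) of x^n - 1 vanishes at most at 0, which is not a root.\<close>

lemma card_roots_of_unity: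
  assumes "of_nat n \<noteq> (0::'a::alg_closed_field)"
  shows "card {z::'a. z ^ n = 1} = n"
proof -
  have n: "n > 0"
    using assms by (cases n) auto
  define p :: "'a poly" where "p = Polynomial.monom 1 n - 1"
  have deg: "Polynomial.degree p = n"
    unfolding p_def using n
    by (intro antisym degree_diff_le le_degree) (auto simp: Polynomial.degree_monom_le)
  have "p \<noteq> 0"
    using deg n by auto
  moreover have "poly (pderiv p) x \<noteq> 0" if "poly p x = 0" for x
    using that assms n
    by (cases n) (auto simp: p_def poly_monom pderiv_diff pderiv_monom)
  ultimately have "card {x. poly p x = 0} = n"
    using card_roots_eq_degree deg by blast
  then show ?thesis
    by (simp add: p_def poly_monom)
qed

text \<open>Multiplication by an n-th root of unity w permutes these roots and scales the sum by
  w^k. Some w has w^k different from 1, since x^k - 1 has at most k < n roots.\<close>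

lemma sum_powers_roots_of_unity:
  assumes "of_nat n \<noteq> (0::'a::alg_closed_field)" and "0 < k" "k < n"
  shows "(\<Sum>z\<in>{z::'a. z ^ n = 1}. z ^ k) = 0"
proof -
  let ?U = "\<lambda>n. {z::'a. z ^ n = 1}"
  define p :: "'a poly" where "p = Polynomial.monom 1 k - 1"
  have "Polynomial.coeff p k = 1"
    using \<open>0 < k\<close> by (simp add: p_def)
  then have p: "p \<noteq> 0" by auto
  have "card (?U k) \<le> Polynomial.degree p"
    using card_poly_roots_bound[OF p] by (simp add: p_def poly_monom)
  also have "\<dots> \<le> k"
    unfolding p_def by (intro degree_diff_le) (auto simp: degree_monom_le)
  finally have "card (?U k) < card (?U n)"
    using assms by (simp add: card_roots_of_unity)
  moreover have "finite (?U k)"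
    using poly_roots_finite[OF p] by (simp add: p_def poly_monom)
  ultimately have "\<not> ?U n \<subseteq> ?U k"
    using card_mono linorder_not_less by blast
  then obtain w :: 'a where w: "w ^ n = 1" "w ^ k \<noteq> 1"
    by blast
  have "w \<noteq> 0"
    using w assms(2,3) by (auto simp: power_0_left)
  have "bij_betw ((*) w) (?U n) (?U n)"
    by (rule bij_betw_byWitness[where f' = "\<lambda>z. z / w"])
       (use w \<open>w \<noteq> 0\<close> in \<open>auto simp: power_mult_distrib power_divide\<close>)
  then have "(\<Sum>z\<in>?U n. z ^ k) = (\<Sum>z\<in>?U n. (w * z) ^ k)"
    by (rule sum.reindex_bij_betw[symmetric])
  also have "\<dots> = w ^ k * (\<Sum>z\<in>?U n. z ^ k)"
    by (simp add: power_mult_distrib sum_distrib_left)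
  finally show ?thesis
    using w(2) by simp
qed

section \<open>Simultaneous diagonalization of the translations\<close>

text \<open>The iterate \<open>((+) h ^^ k) b\<close> stands for k h + b.\<close>

lemma funpow_plus_shift:
  "((+) h ^^ k) (a + b) = a + ((+) h ^^ k) (b::'g::ab_group_add)"
  by (induction k) (simp_all add: algebra_simps)

text \<open>Lagrange's theorem for abelian groups: translating every element by h permutes the
  group, so the sum of all elements is unchanged, although h has been added to it once per
  element.\<close>

lemma funpow_plus_CARD:
  fixes h g :: "'g::{ab_group_add,finite}"
  shows "((+) h ^^ CARD('g)) g = g"
proof -
  let ?s = "\<Sum>x\<in>(UNIV::'g set). x"
  have "(\<Sum>x\<in>A. h + x) = ((+) h ^^ card A) (\<Sum>x\<in>A. x)" for A :: "'g set"
    by (induction A rule: infinite_finite_induct)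
       (simp_all add: funpow_plus_shift add.assoc)
  then have "((+) h ^^ CARD('g)) ?s = (\<Sum>x\<in>UNIV. h + x)"
    by simp
  also have "\<dots> = ?s"
    by (rule sum.reindex_bij_betw) simp
  finally show ?thesis
    using funpow_plus_shift[of "CARD('g)" h "g - ?s" ?s] by simp
qed

text \<open>For \<open>F = UNIV\<close> the nonzero members are the scalar multiples of characters
  of the group. The parameter \<open>F\<close> allows the translations to be treated one at a
  time.\<close>

definition shift_eigenvectors :: "'g::{ab_group_add,finite} set \<Rightarrow> ('a::field, 'g) vec set" where
  "shift_eigenvectors F = {v. \<forall>h\<in>F. \<exists>c. \<forall>g. v $ (h + g) = c * v $ g}"

text \<open>Each step of the induction splits a joint eigenvector for \<open>F\<close> into its
  components in the eigenspaces of translation by h. These stay eigenvectors for \<open>F\<close>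
  because translations commute.\<close>

lemma span_shift_eigenvectors:
  fixes F :: "'g::{ab_group_add,finite} set"
  assumes N: "of_nat CARD('g) \<noteq> (0::'a::alg_closed_field)"
  shows "vec.span (shift_eigenvectors F) = (UNIV :: ('a, 'g) vec set)"
  using finite[of F]
proof (induction F rule: finite_induct)
  case empty
  then show ?case
    by (simp add: shift_eigenvectors_def)
next
  case (insert h F)
  let ?N = "CARD('g)" and ?U = "{z::'a. z ^ CARD('g) = 1}"
  have "w \<in> vec.span (shift_eigenvectors (insert h F))"
    if w: "w \<in> shift_eigenvectors F" for w :: "('a, 'g) vec"
  proof -
    \<comment> \<open>Up to the factor 1/N, this is the projection onto the eigenspace of
      translation by h with eigenvalue 1/z.\<close>
    define proj where "proj z = (\<chi> g. \<Sum>k<?N. z ^ k * w $ (((+) h ^^ k) g))" for z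
    have proj: "proj z \<in> shift_eigenvectors (insert h F)" if z: "z ^ ?N = 1" for z
    proof -
      have "z \<noteq> 0"
        using z by (auto simp: power_0_left)
      have "proj z $ (h + g) = inverse z * proj z $ g" for g
      proof -
        let ?a = "\<lambda>k. z ^ k * w $ (((+) h ^^ k) g)"
        have "z * proj z $ (h + g) = (\<Sum>k<?N. ?a (Suc k))"
          by (simp add: proj_def sum_distrib_left funpow_plus_shift mult.assoc)
        \<comment> \<open>The sum is cyclic: the term at N equals the term at 0, since z^N = 1 and N
          h = 0.\<close>
        also have "\<dots> = (\<Sum>k<?N. ?a k)"
          using sum.lessThan_Suc_shift[of ?a ?N] sum.lessThan_Suc[of ?a ?N]
          by (simp add: z funpow_plus_CARD add.commute)
        finally show ?thesis
          using \<open>z \<noteq> 0\<close> by (simp add: proj_def field_simps)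
      qed
      moreover have "\<exists>c. \<forall>g. proj z $ (f + g) = c * proj z $ g" if f: "f \<in> F" for f
      proof -
        obtain c where c: "\<And>g. w $ (f + g) = c * w $ g"
          using w f unfolding shift_eigenvectors_def by blast
        show ?thesis
          by (rule exI[of _ c])
             (simp add: proj_def funpow_plus_shift c sum_distrib_left mult.left_commute)
      qed
      ultimately show ?thesis
        unfolding shift_eigenvectors_def by blast
    qed
    \<comment> \<open>Summing over the roots of unity kills every term except k = 0.\<close>
    have "(\<Sum>z\<in>?U. proj z $ g) = of_nat ?N * w $ g" for g
    proof -
      have "(\<Sum>z\<in>?U. proj z $ g) = (\<Sum>k<?N. (\<Sum>z\<in>?U. z ^ k) * w $ (((+) h ^^ k) g))"
        unfolding proj_def by (simp add: sum_distrib_right) (rule sum.swap)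
      also have "\<dots> = (\<Sum>k<?N. if k = 0 then of_nat ?N * w $ g else 0)"
        by (intro sum.cong) (auto simp: sum_powers_roots_of_unity[OF N] card_roots_of_unity[OF N])
      finally show ?thesis
        by simp
    qed
    then have "w = (\<Sum>z\<in>?U. inverse (of_nat ?N) *s proj z)"
      using N by (simp add: vec_eq_iff sum_distrib_left[symmetric])
    also have "\<dots> \<in> vec.span (shift_eigenvectors (insert h F))"
      by (intro vec.span_sum vec.span_scale vec.span_base proj) simp
    finally show ?thesis .
  qed
  then have "vec.span (shift_eigenvectors F)
      \<subseteq> vec.span (shift_eigenvectors (insert h F) :: ('a, 'g) vec set)"
    by (intro vec.span_minimal) auto
  with insert.IH show ?case
    by auto
qed

text \<open>The adjacency operator is the sum of the translations by the elements of
  \<open>S\<close>, so its eigenvalue is the sum of theirs.\<close>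

lemma shift_eigenvector_cayley_adj:
  assumes "v \<in> shift_eigenvectors UNIV"
  shows "\<exists>\<mu>. cayley_adj S *v v = \<mu> *s v"
proof -
  obtain c where c: "\<And>h g. v $ (h + g) = c h * v $ g"
    using assms unfolding shift_eigenvectors_def by (auto simp: choice_iff)
  have "(cayley_adj S *v v) $ g = (\<Sum>s\<in>S. c s) * v $ g" for g
  proof -
    have "(cayley_adj S *v v) $ g = (\<Sum>h\<in>UNIV. if h - g \<in> S then v $ h else 0)"
      by (simp add: matrix_vector_mult_def cayley_adj_def if_distrib if_distribR cong: if_cong)
    also have "\<dots> = (\<Sum>s\<in>UNIV. if s \<in> S then v $ (s + g) else 0)"
      by (rule sum.reindex_bij_witness[of _ "\<lambda>s. s + g" "\<lambda>h. h - g"]) auto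
    also have "\<dots> = (\<Sum>s\<in>S. c s) * v $ g"
      by (simp add: sum.If_cases c sum_distrib_right)
    finally show ?thesis .
  qed
  then show ?thesis
    by (auto simp: vec_eq_iff)
qed

section \<open>Polynomials in a matrix\<close>

lemma matrix_mult_sum_right: "A ** (\<Sum>i\<in>I. F i) = (\<Sum>i\<in>I. A ** F i)"
  by (induction I rule: infinite_finite_induct) (simp_all add: matrix_add_ldistrib)

lemma matrix_mult_matscale: "A ** matscale c B = matscale (c::'k::comm_semiring_1) (A ** B)"
  by (simp add: matscale_def matrix_matrix_mult_def vec_eq_iff sum_distrib_left mult.left_commute)

lemma matpoly_0 [simp]: "matpoly 0 A = (0 :: 'k::field ^ 'n::finite ^ 'n)"
  by (simp add: matpoly_def)

lemma matpoly_add: "matpoly (f + g) A = matpoly f A + matpoly g (A :: 'k::field ^ 'n::finite ^ 'n)"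
proof -
  let ?n = "max (Polynomial.degree f) (Polynomial.degree g)"
  show ?thesis
    using matpoly_upto[of f ?n A] matpoly_upto[of g ?n A]
      matpoly_upto[of "f + g" ?n A] Polynomial.degree_add_le_max[of f g]
    by (simp add: sum.distrib matrix_space.scale_left_distrib)
qed

lemma matpoly_smult:
  "matpoly (Polynomial.smult c f) A = matscale c (matpoly f (A :: 'k::field ^ 'n::finite ^ 'n))"
  using matpoly_upto[of f "Polynomial.degree f" A]
    matpoly_upto[of "Polynomial.smult c f" "Polynomial.degree f" A]
  by (simp add: matrix_space.scale_sum_right)

text \<open>Horner's rule, which opens the later identities to induction over the
  coefficients.\<close>

lemma matpoly_pCons:
  "matpoly (pCons c f) A = matscale c (mat 1) + A ** matpoly f (A :: 'k::field ^ 'n::finite ^ 'n)"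
proof -
  have "matpoly (pCons c f) A = (\<Sum>i\<le>Suc (Polynomial.degree f).
      matscale (Polynomial.coeff (pCons c f) i) (matpow A i))"
    by (rule matpoly_upto) (rule degree_pCons_le)
  also have "\<dots> = matscale c (mat 1) + A ** matpoly f A"
    by (subst sum.atMost_Suc_shift)
       (simp add: matpoly_def matrix_mult_sum_right matrix_mult_matscale)
  finally show ?thesis .
qed

lemma matpoly_mult_eq_0:
  fixes A :: "'k::field ^ 'n::finite ^ 'n"
  assumes "matpoly p A = 0"
  shows "matpoly (f * p) A = 0"
proof (induction f rule: pCons_induct)
  case (pCons a f)
  \<comment> \<open>The product is a p + x (f p); the summand \<open>matscale 0 (mat 1)\<close> is
    the zero constant term of x (f p).\<close>
  have "matpoly (pCons a f * p) A = matscale a (matpoly p A) + (matscale 0 (mat 1) + A ** matpoly (f * p) A)"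
    by (simp add: matpoly_add matpoly_smult matpoly_pCons)
  then show ?case
    by (simp add: assms pCons.IH)
qed simp

lemma matpoly_mult_eigenvector:
  fixes M :: "'k::field ^ 'n::finite ^ 'n"
  assumes "M *v v = \<mu> *s v"
  shows "matpoly f M *v v = poly f \<mu> *s v"
proof (induction f rule: pCons_induct)
  case (pCons c f)
  have "matscale c (mat 1) *v v = c *s v"
    by (simp add: matscale_def matrix_vector_mult_def mat_def vec_eq_iff if_distrib if_distribR
        cong: if_cong)
  then show ?case
    by (simp add: matpoly_pCons matrix_vector_mult_add_rdistrib matrix_vector_mul_assoc[symmetric]
        pCons.IH vec.scale assms vec.scale_left_distrib mult.commute)
qed simp

text \<open>On an eigenvector f(M) acts as the scalar f(\<mu>) = 0, and a linear map that vanishes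
  on a spanning set is zero.\<close>

lemma matpoly_eq_0_if_eigenvectors_span:
  fixes M :: "'k::field ^ 'n::finite ^ 'n"
  assumes "vec.span {v. \<exists>\<mu>. M *v v = \<mu> *s v} = UNIV"
    and "\<And>\<mu>. \<mu> \<in> eigenvalues M \<Longrightarrow> poly f \<mu> = 0"
  shows "matpoly f M = 0"
proof -
  have "matpoly f M *v v = 0" if "M *v v = \<mu> *s v" for v \<mu>
    using that assms(2)[of \<mu>] matpoly_mult_eigenvector[OF that, of f]
    \<comment> \<open>The zero vector satisfies the equation for every \<mu>, eigenvalue or
      not.\<close>
    by (cases "v = 0") (auto simp: eigenvalues_def)
  then have "matpoly f M *v v = 0" if "v \<in> vec.span {v. \<exists>\<mu>. M *v v = \<mu> *s v}" for v
    using that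
    by (intro vec.linear_eq_0_on_span[OF matrix_vector_mul_linear_gen, OF _ that]) auto
  then have "matpoly f M *v v = 0 *v v" for v
    using assms(1) by simp
  then show ?thesis
    by (simp add: matrix_eq)
qed

text \<open>The product of x - \<open>m v\<close> over a basis of eigenvectors annihilates M, so
  every eigenvalue is among its finitely many roots.\<close>

lemma finite_eigenvalues_if_eigenvectors_span:
  fixes M :: "'k::field ^ 'n::finite ^ 'n"
  assumes "vec.span {v. \<exists>\<mu>. M *v v = \<mu> *s v} = UNIV"
  shows "finite (eigenvalues M)"
proof -
  obtain B where B: "B \<subseteq> {v. \<exists>\<mu>. M *v v = \<mu> *s v}" "vec.independent B"
    "{v. \<exists>\<mu>. M *v v = \<mu> *s v} \<subseteq> vec.span B"
    using vec.maximal_independent_subset by blast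
  then have fin: "finite B"
    using vec.finiteI_independent by blast
  obtain m where m: "\<And>v. v \<in> B \<Longrightarrow> M *v v = m v *s v"
    using B(1) bchoice[of B "\<lambda>v \<mu>. M *v v = \<mu> *s v"] by blast
  define r where "r = (\<Prod>v\<in>B. [:- m v, 1:])"
  have "matpoly r M *v v = 0" if "v \<in> B" for v
    using that fin by (auto simp: matpoly_mult_eigenvector[OF m] r_def poly_prod)
  then have "matpoly r M *v v = 0" if "v \<in> vec.span B" for v
    using that
    by (intro vec.linear_eq_0_on_span[OF matrix_vector_mul_linear_gen, OF _ that]) auto
  moreover have "vec.span B = UNIV"
    using assms B(3) vec.span_minimal[OF B(3) vec.subspace_span] by auto
  ultimately have "poly r \<mu> = 0" if "\<mu> \<in> eigenvalues M" for \<mu>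
    using that matpoly_mult_eigenvector[of M _ \<mu> r]
    by (fastforce simp: eigenvalues_def)
  then have "eigenvalues M \<subseteq> {x. poly r x = 0}"
    by blast
  moreover have "r \<noteq> 0"
    using fin by (simp add: r_def)
  ultimately show ?thesis
    using poly_roots_finite finite_subset by blast
qed

text \<open>Here \<open>p\<close> is a minimal polynomial up to a scalar. Division by
  \<open>p\<close> shows that the powers of A below its degree span; minimality makes them distinct
  and independent.\<close>

lemma dim_matpoly_algebra:
  fixes A :: "'k::field ^ 'n::finite ^ 'n"
  assumes "p \<noteq> 0" "matpoly p A = 0"
    and min: "\<And>f. matpoly f A = 0 \<Longrightarrow> Polynomial.degree f < Polynomial.degree p \<Longrightarrow> f = 0"
  shows "matrix_space.dim (matpoly_algebra A) = Polynomial.degree p"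
proof -
  let ?d = "Polynomial.degree p"
  let ?B = "matpow A ` {..<?d}"
  \<comment> \<open>The disjunction is the one that a remainder modulo \<open>p\<close> satisfies;
    the zero polynomial has degree 0, which is not below \<open>?d\<close> when \<open>?d\<close> is
    0.\<close>
  have low: "matpoly f A = (\<Sum>i<?d. matscale (Polynomial.coeff f i) (matpow A i))"
    if "f = 0 \<or> Polynomial.degree f < ?d" for f
  proof (cases "f = 0")
    case False
    with that have "{..?d - 1} = {..<?d}" "Polynomial.degree f \<le> ?d - 1"
      by auto
    then show ?thesis
      using matpoly_upto[of f "?d - 1" A] by simp
  qed simp
  have pow: "matpoly (Polynomial.monom 1 i) A = matpow A i" for i
    by (induction i) (simp_all add: Polynomial.monom_0 Polynomial.monom_Suc matpoly_pCons)
  have inj: "inj_on (matpow A) {..<?d}"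
  proof (rule inj_onI)
    fix i j assume ij: "i \<in> {..<?d}" "j \<in> {..<?d}" and eq: "matpow A i = matpow A j"
    let ?f = "Polynomial.monom 1 i + Polynomial.smult (-1) (Polynomial.monom (1::'k) j)"
    have "matpoly ?f A = 0"
      by (simp only: matpoly_add matpoly_smult pow eq) (simp add: matscale_def vec_eq_iff)
    moreover have "Polynomial.degree ?f < ?d"
      using ij by (intro degree_add_less) (auto simp: Polynomial.degree_monom_eq)
    ultimately have "?f = 0"
      by (rule min)
    then have "Polynomial.coeff ?f i = 0"
      by simp
    then show "i = j"
      by (simp split: if_splits)
  qed
  have "matrix_space.independent ?B"
  proof (rule matrix_space.independent_if_scalars_zero)
    fix u x assume sum: "(\<Sum>x\<in>?B. matscale (u x) x) = 0" and "x \<in> ?B"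
    then obtain j where j: "j < ?d" "x = matpow A j"
      by blast
    define f where "f = (\<Sum>i<?d. Polynomial.monom (u (matpow A i)) i)"
    have coeff: "Polynomial.coeff f i = (if i < ?d then u (matpow A i) else 0)" for i
      by (simp add: f_def coeff_sum)
    have deg: "Polynomial.degree f < ?d"
      using j(1) by (intro degree_lessI) (auto simp: coeff)
    have "matpoly f A = (\<Sum>x\<in>?B. matscale (u x) x)"
      using deg by (simp add: low coeff sum.reindex[OF inj])
    then have "f = 0"
      using min sum deg by simp
    then show "u x = 0"
      using coeff[of j] j by simp
  qed simp
  moreover have "?B \<subseteq> matpoly_algebra A"
    unfolding matpoly_algebra_def by (auto simp flip: pow)
  moreover have "matpoly_algebra A \<subseteq> matrix_space.span ?B"
  proof
    fix Y assume "Y \<in> matpoly_algebra A"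
    then obtain f where "Y = matpoly f A"
      unfolding matpoly_algebra_def by blast
    also have "\<dots> = matpoly (f div p * p + f mod p) A"
      by simp
    also have "\<dots> = matpoly (f mod p) A"
      by (simp only: matpoly_add matpoly_mult_eq_0[OF assms(2)] add_0)
    also have "\<dots> = (\<Sum>i<?d. matscale (Polynomial.coeff (f mod p) i) (matpow A i))"
      using degree_mod_less[OF \<open>p \<noteq> 0\<close>] by (intro low)
    also have "\<dots> \<in> matrix_space.span ?B"
      by (intro matrix_space.span_sum matrix_space.span_scale matrix_space.span_base) auto
    finally show "Y \<in> matrix_space.span ?B" .
  qed
  ultimately show ?thesis
    using card_image[OF inj] by (intro matrix_space.dim_unique[of ?B]) auto
qed

section \<open>Descent from the algebraic closure\<close>

lemma map_matrix_matpoly: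
  fixes A :: "'k::field ^ 'n::finite ^ 'n"
  shows "map_matrix to_ac (matpoly f A) = matpoly (map_poly to_ac f) (map_matrix to_ac A)"
proof (induction f rule: pCons_induct)
  case 0
  then show ?case
    by (simp add: vec_eq_iff)
next
  case (pCons c f)
  then show ?case
    by (simp add: map_poly_pCons matpoly_pCons pCons.IH[symmetric])
       (simp add: vec_eq_iff matscale_def mat_def matrix_matrix_mult_def to_ac_sum)
qed

text \<open>\<phi> need not be multiplicative: the entries of A lie in K, so multiplying by A
  commutes with a K-linear map.\<close>

lemma map_matrix_retraction_matpoly:
  fixes A :: "'k::field ^ 'n::finite ^ 'n" and \<phi> :: "'k alg_closure \<Rightarrow> 'k"
  assumes add: "\<And>x y. \<phi> (x + y) = \<phi> x + \<phi> y" and scale: "\<And>a x. \<phi> (to_ac a * x) = a * \<phi> x"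
  shows "map_matrix \<phi> (matpoly r (map_matrix to_ac A)) = matpoly (map_poly \<phi> r) A"
proof -
  have zero: "\<phi> 0 = 0"
    using scale[of 0 0] by simp
  have sum: "\<phi> (\<Sum>i\<in>I. F i) = (\<Sum>i\<in>I. \<phi> (F i))" for I :: "'n set" and F
    by (induction I rule: infinite_finite_induct) (simp_all add: add zero)
  show ?thesis
  proof (induction r rule: pCons_induct)
    case 0
    then show ?case
      by (simp add: vec_eq_iff zero)
  next
    case (pCons c r)
    then show ?case
      by (simp add: map_poly_pCons zero matpoly_pCons pCons.IH[symmetric])
         (simp add: vec_eq_iff matscale_def mat_def matrix_matrix_mult_def add scale sum zero)
  qed
qed

text \<open>Extend {1} to a K-basis of the closure and prescribe the value 1 at 1.\<close>

lemma alg_closure_retraction: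
  obtains \<phi> :: "'k::field alg_closure \<Rightarrow> 'k"
  where "\<And>x y. \<phi> (x + y) = \<phi> x + \<phi> y" "\<And>a x. \<phi> (to_ac a * x) = a * \<phi> x" "\<phi> 1 = 1"
proof -
  interpret vector_space_pair "\<lambda>(a::'k) x. to_ac a * x" "(*) :: 'k \<Rightarrow> 'k \<Rightarrow> 'k"
    by unfold_locales (simp_all add: algebra_simps)
  have ind: "vs1.independent {1}"
    by simp
  let ?\<phi> = "construct {1} (\<lambda>_. 1)"
  interpret phi: Vector_Spaces.linear "\<lambda>(a::'k) x. to_ac a * x" "(*)" ?\<phi>
    by (rule linear_construct[OF ind])
  show ?thesis
    using that[of ?\<phi>] phi.add phi.scale construct_basis[OF ind] by simp
qed

text \<open>The linear algebra of the result, for any matrix over K that is diagonalizable over the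
  closure.\<close>

lemma dim_matpoly_algebra_eq_card_eigenvalues:
  fixes A :: "'k::field ^ 'n::finite ^ 'n"
  defines "M \<equiv> map_matrix to_ac A"
  assumes span: "vec.span {v. \<exists>\<mu>. M *v v = \<mu> *s v} = UNIV"
  shows "matrix_space.dim (matpoly_algebra A) = card (eigenvalues M)"
proof -
  let ?E = "eigenvalues M"
  have fin: "finite ?E"
    using span by (rule finite_eigenvalues_if_eigenvectors_span)
  define r where "r = (\<Prod>\<mu>\<in>?E. [:- \<mu>, 1:])"
  have deg_r: "Polynomial.degree r = card ?E"
    unfolding r_def by (subst degree_prod_sum_eq) auto
  have monic_r: "Polynomial.coeff r (card ?E) = 1"
    using lead_coeff_prod[of "\<lambda>\<mu>. [:- \<mu>, 1:]" ?E] deg_r by (simp add: r_def)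
  have "matpoly r M = 0"
    using fin by (intro matpoly_eq_0_if_eigenvectors_span[OF span]) (auto simp: r_def poly_prod)
  obtain \<phi> :: "'k alg_closure \<Rightarrow> 'k"
    where \<phi>: "\<And>x y. \<phi> (x + y) = \<phi> x + \<phi> y" "\<And>a x. \<phi> (to_ac a * x) = a * \<phi> x" "\<phi> 1 = 1"
    using alg_closure_retraction by blast
  have [simp]: "\<phi> 0 = 0"
    using \<phi>(2)[of 0 0] by simp
  define p where "p = map_poly \<phi> r"
  \<comment> \<open>Since \<phi> fixes 1, the leading coefficient survives and the degree does not
    drop.\<close>
  have "Polynomial.coeff p (card ?E) = 1"
    by (simp add: p_def coeff_map_poly monic_r \<phi>(3))
  moreover have "Polynomial.degree p \<le> card ?E"
    unfolding p_def deg_r[symmetric] by (rule map_poly_degree_leq)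
  ultimately have deg_p: "Polynomial.degree p = card ?E" and "p \<noteq> 0"
    using le_degree[of p "card ?E"] by auto
  have "matpoly p A = map_matrix \<phi> (matpoly r M)"
    unfolding p_def M_def using \<phi>(1,2) by (rule map_matrix_retraction_matpoly[symmetric])
  also have "\<dots> = 0"
    by (simp add: \<open>matpoly r M = 0\<close> vec_eq_iff)
  finally have "matpoly p A = 0" .
  moreover have "f = 0" if f: "matpoly f A = 0" and deg: "Polynomial.degree f < card ?E" for f
  proof (rule ccontr)
    assume "f \<noteq> 0"
    define f' where "f' = map_poly to_ac f"
    have "f' \<noteq> 0"
      using \<open>f \<noteq> 0\<close> by (simp add: f'_def map_poly_eq_0_iff)
    have "matpoly f' M = 0"
      using map_matrix_matpoly[of f A] f by (simp add: f'_def M_def vec_eq_iff)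
    \<comment> \<open>For a nonzero eigenvector v, 0 = f'(M) v = f'(\<mu>) v.\<close>
    then have "poly f' \<mu> = 0" if "\<mu> \<in> ?E" for \<mu>
      using that matpoly_mult_eigenvector[of M _ \<mu> f'] by (fastforce simp: eigenvalues_def)
    then have "card ?E \<le> card {x. poly f' x = 0}"
      using poly_roots_finite[OF \<open>f' \<noteq> 0\<close>] by (intro card_mono) auto
    also have "\<dots> \<le> Polynomial.degree f'"
      using \<open>f' \<noteq> 0\<close> by (rule card_poly_roots_bound)
    also have "\<dots> \<le> Polynomial.degree f"
      unfolding f'_def by (rule map_poly_degree_leq)
    finally show False
      using deg by simp
  qed
  ultimately show ?thesis
    using dim_matpoly_algebra[of p A] \<open>p \<noteq> 0\<close> deg_p by simp
qed

theorem corollary7p1: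
  fixes S :: "'g::{ab_group_add,finite} set"
  assumes "0 \<notin> S"
    and "S = uminus ` S"
    and "\<not> CHAR('k::field) dvd CARD('g)"
  shows "matrix_space.dim (spectral_algebra S :: ('k, 'g) sq_matrix set) =
         card (eigenvalues (map_matrix to_ac (cayley_adj S :: ('k, 'g) sq_matrix)))"
proof -
  let ?M = "map_matrix to_ac (cayley_adj S :: ('k, 'g) sq_matrix)"
  \<comment> \<open>The entries are 0 and 1, so extending scalars gives the adjacency matrix over
    the closure.\<close>
  have M: "?M = cayley_adj S"
    by (simp add: cayley_adj_def vec_eq_iff)
  have "of_nat CARD('g) \<noteq> (0 :: 'k alg_closure)"
    using assms(3) by (simp add: of_nat_eq_0_iff_char_dvd)
  then have "vec.span (shift_eigenvectors UNIV :: ('k alg_closure, 'g) vec set) = UNIV"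
    by (rule span_shift_eigenvectors)
  moreover have "shift_eigenvectors UNIV \<subseteq> {v. \<exists>\<mu>. ?M *v v = \<mu> *s v}"
    using shift_eigenvector_cayley_adj unfolding M by blast
  ultimately have "vec.span {v. \<exists>\<mu>. ?M *v v = \<mu> *s v} = UNIV"
    using vec.span_mono by blast
  then show ?thesis
    unfolding spectral_algebra_def by (rule dim_matpoly_algebra_eq_card_eigenvalues)
qed

end
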